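(* Let $n\ge 3$ and let $R_1$ be the $(n+2)$-dimensional complex solvable Leibniz algebra with basis $\{e_1,\dots,e_n,x,y\}$ and multiplication $$[e_i,e_1]=e_{i+1}\ (2\le i\le n-1),\quad [e_1,x]=e_1,\quad [x,e_1]=-e_1,$$ $$[e_i,x]=(i-1)e_i\ (2\le i\le n),\quad [e_i,y]=e_i\ (2\le i\le n),$$ all other products of basis elements being zero. A linear map $\varphi:R_1\to R_1$ is an automorphism of $R_1$ if and only if there exist $\alpha,\beta,\gamma\in\mathbb{C}$ with $\alpha\beta\neq 0$ such that $$\varphi(e_1)=\alpha e_1,\qquad \varphi(e_i)=\sum_{j=i}^n \frac{(-1)^{j-i}\alpha^{i-2}\beta\gamma^{j-i}}{(j-i)!}\,e_j\ \ (2\le i\le n),$$ $$\varphi(x)=\gamma e_1+x,\qquad \varphi(y)=y.$$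
   Context: All algebras are over $\mathbb{C}$. A Leibniz algebra is a vector space $L$ with a bilinear product $[-,-]$ satisfying $[[x,y],z]=[[x,z],y]+[x,[y,z]]$ for all $x,y,z\in L$ (the product need not be antisymmetric). In multiplication tables, products of basis elements that are not listed are zero. An automorphism of $L$ is a bijective linear map $\varphi:L\to L$ with $\varphi([u,v])=[\varphi(u),\varphi(v)]$ for all $u,v\in L$. Convention: $t^0=1$ for every $t\in\mathbb{C}$, including $t=0$. *)

theory Defs
  imports Complex_Main
begin

locale leibniz_algebra = vector_space scale
  for scale :: "complex \<Rightarrow> 'a::ab_group_add \<Rightarrow> 'a" (infixr "*s" 75) +
  fixes bracket :: "'a \<Rightarrow> 'a \<Rightarrow> 'a"
  assumes bracket_add_left: "bracket (u + v) w = bracket u w + bracket v w"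
    and bracket_add_right: "bracket u (v + w) = bracket u v + bracket u w"
    and bracket_scale_left: "bracket (c *s u) v = c *s bracket u v"
    and bracket_scale_right: "bracket u (c *s v) = c *s bracket u v"
    and leibniz: "bracket (bracket u v) w = bracket (bracket u w) v + bracket u (bracket v w)"
begin

definition automorphism :: "('a \<Rightarrow> 'a) \<Rightarrow> bool" where
  "automorphism f \<longleftrightarrow>
     Vector_Spaces.linear scale scale f \<and> bij f \<and> (\<forall>u v. f (bracket u v) = bracket (f u) (f v))"

end

text \<open>The algebra is fixed by its multiplication table on the basis \<open>e 1, \<dots>, e n, x, y\<close>; values of
  \<open>e\<close> outside \<open>{1..n}\<close> are irrelevant.  Distinctness is stated separately because
  \<open>independent\<close> only sees the set of basis vectors.\<close>

locale R1_algebra = leibniz_algebra scale bracket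
  for scale :: "complex \<Rightarrow> 'a::ab_group_add \<Rightarrow> 'a" (infixr "*s" 75)
    and bracket :: "'a \<Rightarrow> 'a \<Rightarrow> 'a" +
  fixes n :: nat and e :: "nat \<Rightarrow> 'a" and x y :: 'a
  assumes n_ge_3: "n \<ge> 3"
    and basis_distinct: "distinct (map e [1..<Suc n] @ [x, y])"
    and basis_independent: "independent (e ` {1..n} \<union> {x, y})"
    and basis_span: "span (e ` {1..n} \<union> {x, y}) = UNIV"
    and bracket_e_e: "\<lbrakk>i \<in> {1..n}; j \<in> {1..n}\<rbrakk> \<Longrightarrow>
          bracket (e i) (e j) = (if 2 \<le> i \<and> i \<le> n - 1 \<and> j = 1 then e (i + 1) else 0)"
    and bracket_e_x: "i \<in> {1..n} \<Longrightarrow>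
          bracket (e i) x = (if i = 1 then e 1 else of_nat (i - 1) *s e i)"
    and bracket_e_y: "i \<in> {1..n} \<Longrightarrow> bracket (e i) y = (if i = 1 then 0 else e i)"
    and bracket_x_e: "i \<in> {1..n} \<Longrightarrow> bracket x (e i) = (if i = 1 then - e 1 else 0)"
    and bracket_y_e: "i \<in> {1..n} \<Longrightarrow> bracket y (e i) = 0"
    and bracket_x_x: "bracket x x = 0"
    and bracket_x_y: "bracket x y = 0"
    and bracket_y_x: "bracket y x = 0"
    and bracket_y_y: "bracket y y = 0"

end

theory Submission
  imports Defs
begin

text \<open>
  For the forward direction, the structure constants force the shape of \<open>\<phi>\<close> step by step. The element
  \<open>y\<close> annihilates everything from the left, so \<open>\<phi> y\<close> does too, which leaves \<open>\<phi> y = q y\<close>; since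
  \<open>[\<phi> e\<^sub>2, \<phi> y] = \<phi> e\<^sub>2\<close> and right multiplication by \<open>y\<close> is a projection, \<open>q = 1\<close> and \<open>\<phi> e\<^sub>2\<close> lies in the span
  of \<open>e\<^sub>2, \<dots>, e\<^sub>n\<close>. The elements \<open>\<phi> e\<^sub>1\<close> and \<open>\<phi> x\<close> lie in the kernel of that projection, and
  \<open>[\<phi> e\<^sub>1, \<phi> x] = \<phi> e\<^sub>1\<close> gives \<open>\<phi> e\<^sub>1 = \<alpha> e\<^sub>1\<close> and \<open>\<phi> x = \<gamma> e\<^sub>1 + x + s y\<close>. Writing
  \<open>\<phi> e\<^sub>2 = \<Sum> b\<^sub>j e\<^sub>j\<close>, one has \<open>\<phi> e\<^sub>n = \<alpha>\<^sup>n\<^sup>-\<^sup>2 b\<^sub>2 e\<^sub>n\<close>, hence \<open>b\<^sub>2 \<noteq> 0\<close>, and comparing coefficients in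
  \<open>[\<phi> e\<^sub>2, \<phi> x] = \<phi> e\<^sub>2\<close> yields \<open>s = 0\<close> and \<open>(j - 2) b\<^sub>j = - \<gamma> b\<^sub>j\<^sub>-\<^sub>1\<close>, whose solution is the stated formula.
  Conversely, the maps of the stated form respect products of basis vectors and are triangular with
  nonzero diagonal.
\<close>

section \<open>Bilinearity and homomorphisms on a spanning set\<close>

context leibniz_algebra
begin

lemma bracket_zero: "bracket 0 v = 0" "bracket u 0 = 0"
  using bracket_add_left[of 0 0 v] bracket_add_right[of u 0 0] by simp_all

lemma bracket_sum_left: "bracket (\<Sum>j\<in>A. f j) v = (\<Sum>j\<in>A. bracket (f j) v)"
  by (induction A rule: infinite_finite_induct) (auto simp: bracket_zero bracket_add_left)

lemma bracket_sum_right: "bracket u (\<Sum>j\<in>A. f j) = (\<Sum>j\<in>A. bracket u (f j))"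
  by (induction A rule: infinite_finite_induct) (auto simp: bracket_zero bracket_add_right)

text \<open>Both sides are bilinear in \<open>u\<close> and \<open>v\<close>: span induction in
  \<open>v\<close> with \<open>u\<close> a generator, then in \<open>u\<close>, reduces the product
  law to pairs of generators.\<close>

lemma bracket_hom_if_spanning:
  assumes "Vector_Spaces.linear scale scale f"
    and span: "span B = UNIV"
    and B: "\<And>u v. u \<in> B \<Longrightarrow> v \<in> B \<Longrightarrow>
             f (bracket u v) = bracket (f u) (f v)"
  shows "f (bracket u v) = bracket (f u) (f v)"
proof -
  interpret f: Vector_Spaces.linear scale scale f by fact
  have 1: "f (bracket u v) = bracket (f u) (f v)" if u: "u \<in> B" for u v
  proof -
    have "v \<in> span B" by (simp only: span UNIV_I)
    then show ?thesis
      by (induction rule: span_induct_alt)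
        (auto simp: bracket_zero f.zero f.add f.scale bracket_add_right bracket_scale_right B[OF u])
  qed
  have "u \<in> span B" by (simp only: span UNIV_I)
  then show ?thesis
    by (induction rule: span_induct_alt)
      (auto simp: bracket_zero f.zero f.add f.scale bracket_add_left bracket_scale_left 1)
qed

end

text \<open>For i \<le> j this is the e_j-coordinate of exp(-\<gamma> N) applied to \<alpha>^(i-2)
  \<beta> e_i, where N shifts e_i to e_(i+1). For j < i truncated subtraction gives a value that
  need not vanish, hence the guards \<open>i \<le> j\<close> below.\<close>

definition coef :: "complex \<Rightarrow> complex \<Rightarrow> complex \<Rightarrow> nat \<Rightarrow> nat \<Rightarrow> complex" where
  "coef \<alpha> \<beta> \<gamma> i j = (-1) ^ (j - i) * \<alpha> ^ (i - 2) * \<beta> * \<gamma> ^ (j - i) / fact (j - i)"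

text \<open>Comes from (m+1)! = (m+1) m!. The recursion verifies products with \<phi> x in one
  direction and determines the unknown coefficients in the other.\<close>

lemma coef_Suc_right:
  assumes "i \<le> j"
  shows "of_nat (Suc j - i) * coef \<alpha> \<beta> \<gamma> i (Suc j) = - \<gamma> * coef \<alpha> \<beta> \<gamma> i j"
proof -
  have "Suc j - i = Suc (j - i)" using assms by simp
  then show ?thesis
    by (simp add: coef_def divide_simps del: of_nat_Suc)
qed

text \<open>The difference j - i is unchanged and the exponent i - 2 grows by one, untruncated
  because 2 \<le> i. This mirrors [e_i, e_1] = e_(i+1) under \<phi> e_1 = \<alpha> e_1.\<close>

lemma coef_Suc_Suc:
  assumes "2 \<le> i"
  shows "coef \<alpha> \<beta> \<gamma> (Suc i) (Suc j) = \<alpha> * coef \<alpha> \<beta> \<gamma> i j"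
  using assms by (auto simp: coef_def Suc_diff_le dest: le_Suc_ex)

section \<open>Coordinates with respect to the basis\<close>

context R1_algebra
begin

text \<open>Only the values of \<open>c\<close> on \<open>{1..n}\<close> count, so vectors are
  compared by \<open>vec_cong\<close> and \<open>vec_eqD\<close>, not by equality of coordinate
  functions.\<close>

definition vec :: "(nat \<Rightarrow> complex) \<Rightarrow> complex \<Rightarrow> complex \<Rightarrow> 'a" where
  "vec c p q = (\<Sum>j=1..n. c j *s e j) + p *s x + q *s y"

lemma vec_cong:
  assumes "\<And>j. j \<in> {1..n} \<Longrightarrow> c j = c' j" "p = p'" "q = q'"
  shows "vec c p q = vec c' p' q'"
  using assms by (simp add: vec_def)

lemma vec_add: "vec c p q + vec c' p' q' = vec (\<lambda>j. c j + c' j) (p + p') (q + q')"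
  by (simp add: vec_def scale_left_distrib sum.distrib algebra_simps)

lemma vec_scale: "k *s vec c p q = vec (\<lambda>j. k * c j) (k * p) (k * q)"
  by (simp add: vec_def scale_right_distrib scale_sum_right)

lemma vec_zero: "0 = vec (\<lambda>j. 0) 0 0"
  by (simp add: vec_def)

lemma vec_e: "i \<in> {1..n} \<Longrightarrow> e i = vec (\<lambda>j. if j = i then 1 else 0) 0 0"
  by (simp add: vec_def if_distrib[of "\<lambda>c. c *s _"] cong: if_cong)

lemma vec_x: "x = vec (\<lambda>j. 0) 1 0"
  by (simp add: vec_def)

lemma vec_y: "y = vec (\<lambda>j. 0) 0 1"
  by (simp add: vec_def)

lemma e_inj: "inj_on e {1..n}"
  using basis_distinct by (simp add: distinct_map atLeastLessThanSuc_atLeastAtMost del: upt_Suc)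

lemma e_x_y: "x \<notin> e ` {1..n}" "y \<notin> e ` {1..n}" "x \<noteq> y"
  using basis_distinct by (auto simp: atLeastLessThanSuc_atLeastAtMost simp del: upt_Suc)

lemma sum_basis: "(\<Sum>b\<in>e ` {1..n} \<union> {x, y}. g b *s b) = vec (\<lambda>j. g (e j)) (g x) (g y)"
  using e_x_y by (simp add: vec_def sum.union_disjoint sum.reindex[OF e_inj] add.assoc del: One_nat_def)

lemma vec_exhaust:
  obtains c p q where "v = vec c p q"
proof -
  have "v \<in> span (e ` {1..n} \<union> {x, y})"
    using basis_span by simp
  then obtain g where "v = (\<Sum>b\<in>e ` {1..n} \<union> {x, y}. g b *s b)"
    by (subst (asm) span_finite) auto
  then show thesis
    using that sum_basis by metis
qed

lemma vec_eq_0D: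
  assumes "vec c p q = 0"
  shows "j \<in> {1..n} \<Longrightarrow> c j = 0" "p = 0" "q = 0"
proof -
  \<comment> \<open>Independence concerns coefficients indexed by basis vectors. Distinctness of the
    basis lets \<open>g\<close> recover the index from the vector.\<close>
  define g where "g b = (if b = x then p else if b = y then q else c (the_inv_into {1..n} e b))" for b
  have g: "g (e j) = c j" if "j \<in> {1..n}" for j
    using that e_x_y the_inv_into_f_f[OF e_inj that] by (auto simp: g_def)
  have gxy: "g x = p" "g y = q"
    using e_x_y by (auto simp: g_def)
  have "(\<Sum>b\<in>e ` {1..n} \<union> {x, y}. g b *s b) = 0"
    unfolding sum_basis gxy using g assms by (subst vec_cong[of _ c]) auto
  then have "g b = 0" if "b \<in> e ` {1..n} \<union> {x, y}" for b
    using independentD[OF basis_independent _ order_refl] that by simp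
  then show "j \<in> {1..n} \<Longrightarrow> c j = 0" "p = 0" "q = 0"
    using g gxy by auto
qed

lemma vec_eqD:
  assumes "vec c p q = vec c' p' q'"
  shows "j \<in> {1..n} \<Longrightarrow> c j = c' j" "p = p'" "q = q'"
proof -
  have "vec (\<lambda>j. c j - c' j) (p - p') (q - q') = vec c p q + (-1) *s vec c' p' q'"
    unfolding vec_scale vec_add by simp
  also have "\<dots> = 0"
    using assms by simp
  finally have "vec (\<lambda>j. c j - c' j) (p - p') (q - q') = 0" .
  from vec_eq_0D[OF this] show "j \<in> {1..n} \<Longrightarrow> c j = c' j" "p = p'" "q = q'"
    by auto
qed

section \<open>The product in coordinates\<close>

lemma bracket_vec_left:
  "bracket (vec c p q) v = (\<Sum>j=1..n. c j *s bracket (e j) v) + p *s bracket x v + q *s bracket y v"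
  by (simp add: vec_def bracket_add_left bracket_scale_left bracket_sum_left)

lemma bracket_vec_e1:
  "bracket (vec c p q) (e 1) = vec (\<lambda>j. if j = 1 then - p else if j = 2 then 0 else c (j - 1)) 0 0"
proof -
  have 1: "1 \<in> {1..n}" using n_ge_3 by simp
  \<comment> \<open>The terms j = 1 and j = n vanish. After the shift only e_3, ..., e_n occur, so
    coordinate 2 of the product is 0 and coordinate 1 comes from [x, e_1] = -e_1 alone.\<close>
  have "(\<Sum>j=1..n. c j *s bracket (e j) (e 1)) = (\<Sum>j=2..n-1. c j *s e (Suc j))"
    using n_ge_3 by (intro sum.mono_neutral_cong_right) (auto simp: bracket_e_e)
  also have "\<dots> = (\<Sum>j=3..n. c (j - 1) *s e j)"
    using n_ge_3 by (intro sum.reindex_bij_witness[of _ "\<lambda>j. j - 1" Suc]) auto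
  finally have *: "(\<Sum>j=1..n. c j *s bracket (e j) (e 1)) = (\<Sum>j=3..n. c (j - 1) *s e j)" .
  have "{1..n} = insert 1 (insert 2 {3..n})" using n_ge_3 by auto
  then have "(\<Sum>j=1..n. (if j = 1 then - p else if j = 2 then 0 else c (j - 1)) *s e j)
      = - p *s e 1 + (\<Sum>j=3..n. c (j - 1) *s e j)"
    by (simp del: One_nat_def)
  then show ?thesis
    unfolding bracket_vec_left * unfolding vec_def using 1
    by (simp add: bracket_x_e bracket_y_e del: One_nat_def)
qed

lemma bracket_vec_x: "bracket (vec c p q) x = vec (\<lambda>j. if j = 1 then c 1 else of_nat (j - 1) * c j) 0 0"
proof -
  have "(\<Sum>j=1..n. c j *s bracket (e j) x) = (\<Sum>j=1..n. (if j = 1 then c 1 else of_nat (j - 1) * c j) *s e j)"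
    by (intro sum.cong) (auto simp: bracket_e_x mult.commute)
  then show ?thesis
    unfolding bracket_vec_left unfolding vec_def by (simp add: bracket_x_x bracket_y_x del: One_nat_def)
qed

lemma bracket_vec_y: "bracket (vec c p q) y = vec (\<lambda>j. if j = 1 then 0 else c j) 0 0"
proof -
  have "(\<Sum>j=1..n. c j *s bracket (e j) y) = (\<Sum>j=1..n. (if j = 1 then 0 else c j) *s e j)"
    by (intro sum.cong) (auto simp: bracket_e_y)
  then show ?thesis
    unfolding bracket_vec_left unfolding vec_def by (simp add: bracket_x_y bracket_y_y del: One_nat_def)
qed

text \<open>In the table, nonzero products have e_1, x or y as right factor.\<close>

lemma bracket_e_right:
  assumes "j \<in> {2..n}"
  shows "bracket u (e j) = 0"
proof -
  obtain c p q where u: "u = vec c p q" by (rule vec_exhaust)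
  show ?thesis
    using assms by (simp add: u bracket_vec_left bracket_e_e bracket_x_e bracket_y_e)
qed

text \<open>The right factor acts only through its coordinates at e_1, x and y: on e_j with j \<ge>
  2, x scales by j - 1, y is the identity, and e_1 shifts the index up by one.\<close>

lemma bracket_vec_vec:
  "bracket (vec c p q) (vec c' p' q') =
     vec (\<lambda>j. if j = 1 then c 1 * p' - p * c' 1
              else (of_nat (j - 1) * p' + q') * c j + (if j = 2 then 0 else c (j - 1) * c' 1)) 0 0"
proof -
  let ?u = "vec c p q"
  have "{1..n} = insert 1 {2..n}" using n_ge_3 by auto
  then have "bracket ?u (vec c' p' q')
      = c' 1 *s bracket ?u (e 1) + p' *s bracket ?u x + q' *s bracket ?u y"
    by (simp add: vec_def[of c'] bracket_add_right bracket_scale_right bracket_sum_right bracket_e_right)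
  also have "\<dots> = vec (\<lambda>j. if j = 1 then c 1 * p' - p * c' 1
              else (of_nat (j - 1) * p' + q') * c j + (if j = 2 then 0 else c (j - 1) * c' 1)) 0 0"
    unfolding bracket_vec_e1 bracket_vec_x bracket_vec_y vec_scale vec_add
    by (rule vec_cong) (auto simp: algebra_simps)
  finally show ?thesis .
qed

lemma sum_coef_vec:
  assumes "2 \<le> i"
  shows "(\<Sum>j=i..n. c j *s e j) = vec (\<lambda>j. if i \<le> j then c j else 0) 0 0"
proof -
  have "(\<Sum>j=i..n. c j *s e j) = (\<Sum>j=1..n. (if i \<le> j then c j else 0) *s e j)"
    using assms by (intro sum.mono_neutral_cong_left) auto
  then show ?thesis by (simp add: vec_def)
qed

text \<open>Allows injectivity of \<phi> to be deduced from surjectivity.\<close>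

lemma finite_dimensional:
  "finite_dimensional_vector_space scale (e ` {1..n} \<union> {x, y})"
  using basis_independent basis_span by unfold_locales auto

context
  fixes \<phi> :: "'a \<Rightarrow> 'a"
  assumes linear: "Vector_Spaces.linear scale scale \<phi>"
begin

interpretation \<phi>: Vector_Spaces.linear scale scale \<phi> by (fact linear)

section \<open>Maps in normal form are automorphisms\<close>

lemma automorphism_if_normal_form:
  assumes nz: "\<alpha> * \<beta> \<noteq> 0"
    and e1: "\<phi> (e 1) = \<alpha> *s e 1"
    and ei: "\<And>i. i \<in> {2..n} \<Longrightarrow> \<phi> (e i) = (\<Sum>j=i..n. coef \<alpha> \<beta> \<gamma> i j *s e j)"
    and x: "\<phi> x = \<gamma> *s e 1 + x" and y: "\<phi> y = y"
  shows "automorphism \<phi>"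
proof -
  interpret fd: finite_dimensional_vector_space scale "e ` {1..n} \<union> {x, y}"
    by (rule finite_dimensional)
  have n1: "1 \<in> {1..n}" using n_ge_3 by simp
  have sub: "subspace (range \<phi>)"
    using \<phi>.subspace_image[OF subspace_UNIV] .
  have e1_range: "e 1 \<in> range \<phi>"
    using subspace_scale[OF sub rangeI[of \<phi> "e 1"], of "1 / \<alpha>", unfolded e1] nz
    by (simp del: One_nat_def)
  have e_range: "e i \<in> range \<phi>" if "i \<in> {2..n}" for i
    using that
  \<comment> \<open>Back substitution from e_n downwards: the terms beyond the diagonal are in the
    range by induction, and the diagonal entry \<alpha>^(i-2) \<beta> can be divided out.\<close>
  proof (induction "n - i" arbitrary: i rule: less_induct)
    case less
    have "{i..n} = insert i {Suc i..n}" using less.prems by auto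
    then have "\<phi> (e i) = coef \<alpha> \<beta> \<gamma> i i *s e i + (\<Sum>j=Suc i..n. coef \<alpha> \<beta> \<gamma> i j *s e j)"
      using ei[OF less.prems] by simp
    then have "coef \<alpha> \<beta> \<gamma> i i *s e i = \<phi> (e i) - (\<Sum>j=Suc i..n. coef \<alpha> \<beta> \<gamma> i j *s e j)"
      by simp
    also have "\<dots> \<in> range \<phi>"
      using less by (intro subspace_diff[OF sub] subspace_sum[OF sub] subspace_scale[OF sub]) auto
    finally have "(1 / coef \<alpha> \<beta> \<gamma> i i) *s (coef \<alpha> \<beta> \<gamma> i i *s e i) \<in> range \<phi>"
      by (rule subspace_scale[OF sub])
    moreover have "coef \<alpha> \<beta> \<gamma> i i \<noteq> 0" using nz by (simp add: coef_def)
    ultimately show ?case by simp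
  qed
  have x_range: "x \<in> range \<phi>"
    using subspace_diff[OF sub rangeI[of \<phi> x] subspace_scale[OF sub e1_range, of \<gamma>]] by (simp add: x)
  have y_range: "y \<in> range \<phi>"
    using rangeI[of \<phi> y] by (simp add: y)
  have "e ` {1..n} \<union> {x, y} \<subseteq> range \<phi>"
  proof -
    have "{1..n} = insert 1 {2..n}" using n_ge_3 by auto
    then show ?thesis using e1_range e_range x_range y_range by auto
  qed
  then have surj: "surj \<phi>"
    using span_minimal[OF _ sub, of "e ` {1..n} \<union> {x, y}"] unfolding basis_span by (simp only: top.extremum_unique)
  then have inj: "inj \<phi>"
    using fd.linear_surj_imp_inj[OF linear] by blast
  have phi_e: "\<phi> (e i) = vec (\<lambda>j. if i \<le> j then coef \<alpha> \<beta> \<gamma> i j else 0) 0 0" if "i \<in> {2..n}" for i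
    using that by (simp add: ei sum_coef_vec)
  have phi_e1: "\<phi> (e 1) = vec (\<lambda>j. if j = 1 then \<alpha> else 0) 0 0"
    unfolding e1 unfolding vec_e[OF n1] vec_scale by (rule vec_cong) auto
  have phi_x: "\<phi> x = vec (\<lambda>j. if j = 1 then \<gamma> else 0) 1 0"
    unfolding x unfolding vec_e[OF n1] vec_scale by (subst vec_x, unfold vec_add, rule vec_cong) auto
  have phi_y: "\<phi> y = vec (\<lambda>j. 0) 0 1"
    using y vec_y by simp
  \<comment> \<open>\<phi> e_j is a combination of e_j, ..., e_n, all of which annihilate from the
    right.\<close>
  have right0: "bracket u (\<phi> (e j)) = 0" if "j \<in> {2..n}" for u j
    using that by (simp add: ei bracket_sum_right bracket_scale_right bracket_e_right)
  have right_e: "\<phi> (bracket u (e j)) = bracket (\<phi> u) (\<phi> (e j))" if "j \<in> {2..n}" for u j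
    using right0[OF that] by (simp add: bracket_e_right[OF that])
  have e_e1: "\<phi> (bracket (e i) (e 1)) = bracket (\<phi> (e i)) (\<phi> (e 1))" if i: "i \<in> {2..n}" for i
  proof (cases "i = n")
    case True
    have "bracket (\<phi> (e i)) (\<phi> (e 1)) = 0"
      unfolding phi_e[OF i] phi_e1 bracket_vec_vec vec_zero
      using i True by (intro vec_cong) auto
    then show ?thesis using i n1 True n_ge_3 \<phi>.zero by (subst bracket_e_e) auto
  next
    case False
    have "bracket (\<phi> (e i)) (\<phi> (e 1)) = \<phi> (e (Suc i))"
    proof -
      have si: "Suc i \<in> {2..n}" using i False by auto
      show ?thesis
        unfolding phi_e[OF i] phi_e[OF si] phi_e1 bracket_vec_vec
      proof (rule vec_cong)
        fix j assume "j \<in> {1..n}"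
        then obtain k where "j = Suc k" by (cases j) auto
        then show "(if j = 1 then (if i \<le> 1 then coef \<alpha> \<beta> \<gamma> i 1 else 0) * 0 - 0 * (if (1::nat) = 1 then \<alpha> else 0)
           else (of_nat (j - 1) * 0 + 0) * (if i \<le> j then coef \<alpha> \<beta> \<gamma> i j else 0) +
             (if j = 2 then 0 else (if i \<le> j - 1 then coef \<alpha> \<beta> \<gamma> i (j - 1) else 0) * (if (1::nat) = 1 then \<alpha> else 0)))
          = (if Suc i \<le> j then coef \<alpha> \<beta> \<gamma> (Suc i) j else 0)"
          using i by (auto simp: coef_Suc_Suc)
      qed auto
    qed
    then show ?thesis using i n1 False by (auto simp: bracket_e_e)
  qed
  have e_x: "\<phi> (bracket (e i) x) = bracket (\<phi> (e i)) (\<phi> x)" if i: "i \<in> {2..n}" for i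
  proof -
    have "bracket (\<phi> (e i)) (\<phi> x) = of_nat (i - 1) *s \<phi> (e i)"
      unfolding phi_e[OF i] phi_x bracket_vec_vec vec_scale
    proof (rule vec_cong)
      fix j assume "j \<in> {1..n}"
      then obtain k where j: "j = Suc k" by (cases j) auto
      \<comment> \<open>The e_(k+1)-coordinate of the eigenvector equation for right multiplication
        by \<gamma> e_1 + x with eigenvalue i - 1. At k + 1 = i the shifted term is absent, and for
        k + 1 < i both sides vanish.\<close>
      have "of_nat k * coef \<alpha> \<beta> \<gamma> i (Suc k) + coef \<alpha> \<beta> \<gamma> i k * \<gamma> = of_nat (i - 1) * coef \<alpha> \<beta> \<gamma> i (Suc k)"
        if "i \<le> k"
        using coef_Suc_right[OF that, of \<alpha> \<beta> \<gamma>] that i by (simp add: of_nat_diff algebra_simps)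
      moreover have "i \<le> k \<or> i = Suc k \<or> Suc k < i" by auto
      ultimately show "(if j = 1 then (if i \<le> 1 then coef \<alpha> \<beta> \<gamma> i 1 else 0) * 1 - 0 * (if (1::nat) = 1 then \<gamma> else 0)
           else (of_nat (j - 1) * 1 + 0) * (if i \<le> j then coef \<alpha> \<beta> \<gamma> i j else 0) +
             (if j = 2 then 0 else (if i \<le> j - 1 then coef \<alpha> \<beta> \<gamma> i (j - 1) else 0) * (if (1::nat) = 1 then \<gamma> else 0)))
          = of_nat (i - 1) * (if i \<le> j then coef \<alpha> \<beta> \<gamma> i j else 0)"
        using i j by auto
    qed auto
    then show ?thesis using i by (simp add: bracket_e_x \<phi>.scale)
  qed
  have e_y: "\<phi> (bracket (e i) y) = bracket (\<phi> (e i)) (\<phi> y)" if i: "i \<in> {2..n}" for i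
  proof -
    have "bracket (\<phi> (e i)) (\<phi> y) = \<phi> (e i)"
      unfolding phi_e[OF i] phi_y bracket_vec_vec using i by (intro vec_cong) auto
    then show ?thesis using i by (simp add: bracket_e_y)
  qed
  \<comment> \<open>For [x, x] the cross terms \<gamma> [e_1, x] and \<gamma> [x, e_1]
    cancel.\<close>
  have low: "\<phi> (bracket u v) = bracket (\<phi> u) (\<phi> v)" if "u \<in> {e 1, x, y}" "v \<in> {e 1, x, y}" for u v
    using that n1
    by (auto simp: e1[unfolded One_nat_def] x y \<phi>.neg \<phi>.zero bracket_e_e bracket_e_x bracket_e_y bracket_x_e bracket_y_e bracket_x_x
        bracket_x_y bracket_y_x bracket_y_y bracket_add_left bracket_add_right bracket_scale_left
        bracket_scale_right mult.commute)
  have B: "e ` {1..n} \<union> {x, y} = {e 1, x, y} \<union> e ` {2..n}"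
  proof -
    have "{1..n} = insert 1 {2..n}" using n_ge_3 by auto
    then show ?thesis by auto
  qed
  have "\<phi> (bracket u v) = bracket (\<phi> u) (\<phi> v)" for u v
  proof (rule bracket_hom_if_spanning[OF linear basis_span])
    fix u v assume u: "u \<in> e ` {1..n} \<union> {x, y}" and v: "v \<in> e ` {1..n} \<union> {x, y}"
    from v consider j where "j \<in> {2..n}" "v = e j" | "v \<in> {e 1, x, y}"
      unfolding B by blast
    then show "\<phi> (bracket u v) = bracket (\<phi> u) (\<phi> v)"
    proof cases
      case 1
      then show ?thesis using right_e by blast
    next
      case 2
      from u consider i where "i \<in> {2..n}" "u = e i" | "u \<in> {e 1, x, y}"
        unfolding B by blast
      then show ?thesis
      proof cases
        case 1
        then show ?thesis using 2 e_e1[OF 1(1)] e_x[OF 1(1)] e_y[OF 1(1)] by blast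
      qed (rule low[OF _ 2])
    qed
  qed
  with surj inj linear show ?thesis
    by (simp add: automorphism_def bij_def)
qed

section \<open>Automorphisms are in normal form\<close>

lemma normal_form_if_automorphism:
  assumes "automorphism \<phi>"
  obtains \<alpha> \<beta> \<gamma> where "\<alpha> * \<beta> \<noteq> 0" "\<phi> (e 1) = \<alpha> *s e 1"
    "\<And>i. i \<in> {2..n} \<Longrightarrow> \<phi> (e i) = (\<Sum>j=i..n. coef \<alpha> \<beta> \<gamma> i j *s e j)"
    "\<phi> x = \<gamma> *s e 1 + x" "\<phi> y = y"
proof -
  have inj: "inj \<phi>" and surj: "surj \<phi>" and hom: "\<And>u v. \<phi> (bracket u v) = bracket (\<phi> u) (\<phi> v)"
    using assms by (auto simp: automorphism_def bij_def)
  have n1: "1 \<in> {1..n}" "2 \<in> {1..n}" "n \<in> {1..n}" using n_ge_3 by auto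
  have nz: "\<phi> (e i) \<noteq> 0" if "i \<in> {1..n}" for i
  proof
    assume "\<phi> (e i) = 0"
    then have "e i = 0" using inj \<phi>.zero by (metis injD)
    then show False
      using vec_eq_0D(1)[of "\<lambda>j. if j = i then 1 else 0" 0 0 i] vec_e[OF that] that by simp
  qed
  obtain cy py qy where y0: "\<phi> y = vec cy py qy" by (rule vec_exhaust)
  have y_left: "bracket (\<phi> y) v = 0" for v
  proof -
    obtain w where v: "v = \<phi> w" using surj by blast
    obtain c p q where w: "w = vec c p q" by (rule vec_exhaust)
    have "bracket y w = 0"
      unfolding w by (subst vec_y, unfold bracket_vec_vec vec_zero, rule vec_cong) auto
    then show ?thesis using hom[of y w] \<phi>.zero by (simp add: v)
  qed
  \<comment> \<open>Right multiplication by x exposes coordinate 1, by y the coordinates from 2 on,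
    and by e_1 the x-coordinate.\<close>
  have "cy j = 0" if "j \<in> {1..n}" for j
  proof (cases "j = 1")
    case True
    then show ?thesis
      using vec_eq_0D(1)[OF y_left[of x, unfolded y0 bracket_vec_x] that] by simp
  next
    case False
    then show ?thesis
      using vec_eq_0D(1)[OF y_left[of y, unfolded y0 bracket_vec_y] that] by simp
  qed
  moreover have "py = 0"
    using vec_eq_0D(1)[OF y_left[of "e 1", unfolded y0 bracket_vec_e1] n1(1)] by simp
  ultimately have y1: "\<phi> y = vec (\<lambda>j. 0) 0 qy"
    unfolding y0 by (intro vec_cong) auto
  obtain c2 p2 q2 where e2: "\<phi> (e 2) = vec c2 p2 q2" by (rule vec_exhaust)
  have "bracket (\<phi> (e 2)) (\<phi> y) = \<phi> (e 2)"
    using hom[of "e 2" y] n1 by (simp add: bracket_e_y)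
  note e2y = vec_eqD[OF this[unfolded y1 e2 bracket_vec_vec]]
  have p2: "p2 = 0" "q2 = 0" "c2 1 = 0"
    using e2y(1)[OF n1(1)] e2y(2,3) by auto
  \<comment> \<open>For j \<ge> 2 the comparison reads \<open>qy * c2 j = c2 j\<close>, so any other
    \<open>qy\<close> would force \<phi> e_2 = 0.\<close>
  have "qy = 1"
  proof (rule ccontr)
    assume "qy \<noteq> 1"
    then have "c2 j = 0" if "j \<in> {1..n}" for j
      using e2y(1)[OF that] p2 by (auto split: if_splits)
    then have "\<phi> (e 2) = 0"
      unfolding e2 vec_zero using p2 by (intro vec_cong) auto
    then show False using nz n1 by blast
  qed
  then have phi_y: "\<phi> y = y" using y1 vec_y by simp
  have y_ker: "\<exists>a p q. \<phi> u = vec (\<lambda>j. if j = 1 then a else 0) p q" if u: "bracket u y = 0" for u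
  proof -
    obtain c p q where u': "\<phi> u = vec c p q" by (rule vec_exhaust)
    have "bracket (vec c p q) y = 0"
      using hom[of u y] u phi_y \<phi>.zero by (simp add: u')
    then have "c j = 0" if "j \<in> {1..n}" "j \<noteq> 1" for j
      using vec_eq_0D(1)[of "\<lambda>j. if j = 1 then 0 else c j" 0 0 j] that by (simp add: bracket_vec_y)
    then have "\<phi> u = vec (\<lambda>j. if j = 1 then c 1 else 0) p q"
      unfolding u' by (intro vec_cong) auto
    then show ?thesis by blast
  qed
  obtain \<alpha> p1 q1 where e1: "\<phi> (e 1) = vec (\<lambda>j. if j = 1 then \<alpha> else 0) p1 q1"
    using y_ker[of "e 1"] n1 by (auto simp: bracket_e_y)
  obtain \<gamma> r s where x0: "\<phi> x = vec (\<lambda>j. if j = 1 then \<gamma> else 0) r s"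
    using y_ker[of x] by (auto simp: bracket_x_y)
  have "bracket (\<phi> (e 1)) (\<phi> x) = \<phi> (e 1)"
    using hom[of "e 1" x] n1 by (simp add: bracket_e_x)
  note e1x = vec_eqD[OF this[unfolded x0 e1 bracket_vec_vec]]
  \<comment> \<open>Products have no x- or y-coordinate, so \<open>p1\<close> and \<open>q1\<close>
    vanish; coordinate 1 reads \<alpha> r - p1 \<gamma> = \<alpha>.\<close>
  have p1: "p1 = 0" "q1 = 0" "\<alpha> * r = \<alpha>"
    using e1x(1)[OF n1(1)] e1x(2,3) by auto
  have alpha: "\<alpha> \<noteq> 0"
  proof
    assume "\<alpha> = 0"
    then have "\<phi> (e 1) = 0"
      unfolding e1 vec_zero using p1 by (intro vec_cong) auto
    then show False using nz n1 by blast
  qed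
  then have r: "r = 1" using p1 by simp
  have phi_e1: "\<phi> (e 1) = \<alpha> *s e 1"
    unfolding e1 unfolding vec_e[OF n1(1)] vec_scale using p1 by (intro vec_cong) auto
  \<comment> \<open>Zero below 2, so that \<open>b (j - k)\<close> vanishes for j < k + 2 even where
    the subtraction truncates; the shift formula then needs no case split.\<close>
  define b where "b j = (if j < 2 then 0 else c2 j)" for j
  have phi_e: "\<phi> (e (k + 2)) = vec (\<lambda>j. \<alpha> ^ k * b (j - k)) 0 0" if "k + 2 \<le> n" for k
    using that
  proof (induction k)
    case 0
    show ?case
      using e2 p2 by (auto simp: b_def numeral_2_eq_2 less_Suc_eq intro!: vec_cong)
  next
    case (Suc k)
    have "\<phi> (e (Suc k + 2)) = bracket (\<phi> (e (k + 2))) (\<phi> (e 1))"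
    proof -
      have "bracket (e (k + 2)) (e 1) = e (Suc k + 2)"
        using Suc.prems n1 by (subst bracket_e_e) auto
      then show ?thesis using hom[of "e (k + 2)" "e 1"] by simp
    qed
    also have "\<dots> = \<alpha> *s bracket (vec (\<lambda>j. \<alpha> ^ k * b (j - k)) 0 0) (e 1)"
      using Suc by (simp add: phi_e1 bracket_scale_right del: One_nat_def)
    also have "\<dots> = vec (\<lambda>j. \<alpha> ^ Suc k * b (j - Suc k)) 0 0"
      unfolding bracket_vec_e1 vec_scale by (rule vec_cong) (auto simp: b_def)
    finally show ?case .
  qed
  have beta: "b 2 \<noteq> 0"
  proof
    assume "b 2 = 0"
    have n: "n - 2 + 2 = n" using n_ge_3 by simp
    have "\<phi> (e n) = vec (\<lambda>j. \<alpha> ^ (n - 2) * b (j - (n - 2))) 0 0"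
      using phi_e[of "n - 2", unfolded n] by simp
    also have "\<dots> = 0"
      unfolding vec_zero
    proof (rule vec_cong)
      fix j assume "j \<in> {1..n}"
      \<comment> \<open>Hence only \<open>b 2\<close> could survive the shift by n - 2, and it is
        assumed to vanish.\<close>
      then have "j - (n - 2) \<le> 2" by auto
      then have "j - (n - 2) < 2 \<or> j - (n - 2) = 2" by linarith
      then have "b (j - (n - 2)) = 0" using \<open>b 2 = 0\<close> by (auto simp: b_def)
      then show "\<alpha> ^ (n - 2) * b (j - (n - 2)) = 0" by simp
    qed auto
    finally show False using nz n1 by blast
  qed
  have e2b: "\<phi> (e 2) = vec b 0 0" using phi_e[of 0] n_ge_3 by (simp add: numeral_2_eq_2)
  have "bracket (\<phi> (e 2)) (\<phi> x) = \<phi> (e 2)"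
    using hom[of "e 2" x] n1 by (simp add: bracket_e_x)
  note e2x = vec_eqD(1)[OF this[unfolded x0 e2b bracket_vec_vec r]]
  \<comment> \<open>Coordinate 2 reads (1 + s) b_2 = b_2.\<close>
  have s: "s = 0"
    using e2x[OF n1(2)] beta by (simp add: algebra_simps)
  have b_coef: "b j = coef \<alpha> (b 2) \<gamma> 2 j" if "2 \<le> j" "j \<le> n" for j
    using that
  proof (induction j rule: dec_induct)
    case base
    show ?case by (simp add: coef_def)
  next
    case (step j)
    \<comment> \<open>Coordinate j + 1 reads j b_(j+1) + \<gamma> b_j = b_(j+1). The factor j - 1 is
      nonzero since j \<ge> 2, so it cancels at the end.\<close>
    have "of_nat (Suc j - 2) * b (Suc j) = - \<gamma> * b j"
      using e2x[of "Suc j"] step s by (simp add: of_nat_diff algebra_simps)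
    also have "\<dots> = of_nat (Suc j - 2) * coef \<alpha> (b 2) \<gamma> 2 (Suc j)"
      using step coef_Suc_right[of 2 j \<alpha> "b 2" \<gamma>] by simp
    finally show ?case using step by (simp del: of_nat_Suc add: of_nat_diff)
  qed
  have ei: "\<phi> (e i) = (\<Sum>j=i..n. coef \<alpha> (b 2) \<gamma> i j *s e j)" if i: "i \<in> {2..n}" for i
  proof -
    obtain k where k: "i = k + 2" using i by (metis atLeastAtMost_iff le_add_diff_inverse2)
    have 2: "2 \<le> i" using i by simp
    show ?thesis
      unfolding sum_coef_vec[OF 2] unfolding k phi_e[of k, OF i[unfolded k, simplified atLeastAtMost_iff, THEN conjunct2]]
    proof (rule vec_cong)
      fix j assume j: "j \<in> {1..n}"
      show "\<alpha> ^ k * b (j - k) = (if k + 2 \<le> j then coef \<alpha> (b 2) \<gamma> (k + 2) j else 0)"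
      proof (cases "k + 2 \<le> j")
        case True
        then show ?thesis using j b_coef[of "j - k"] by (simp add: coef_def)
      next
        case False
        then have "j - k < 2" by linarith
        then show ?thesis using False by (simp add: b_def)
      qed
    qed auto
  qed
  have "\<phi> x = \<gamma> *s e 1 + x"
    unfolding x0 r s unfolding vec_e[OF n1(1)] vec_scale
    by (subst (2) vec_x, unfold vec_add, rule vec_cong) auto
  then show thesis
    using that[of \<alpha> "b 2" \<gamma>] alpha beta phi_e1 ei phi_y by simp
qed

end

end

theorem theorem0p3p2:
  fixes scale :: "complex \<Rightarrow> 'a::ab_group_add \<Rightarrow> 'a"
    and bracket :: "'a \<Rightarrow> 'a \<Rightarrow> 'a"
    and n :: nat and e :: "nat \<Rightarrow> 'a" and x y :: 'a
    and \<phi> :: "'a \<Rightarrow> 'a"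
  assumes "R1_algebra scale bracket n e x y"
    and "Vector_Spaces.linear scale scale \<phi>"
  shows "leibniz_algebra.automorphism scale bracket \<phi> \<longleftrightarrow>
    (\<exists>\<alpha> \<beta> \<gamma> :: complex. \<alpha> * \<beta> \<noteq> 0 \<and>
       \<phi> (e 1) = scale \<alpha> (e 1) \<and>
       (\<forall>i\<in>{2..n}. \<phi> (e i) =
          (\<Sum>j=i..n. scale ((-1) ^ (j - i) * \<alpha> ^ (i - 2) * \<beta> * \<gamma> ^ (j - i) / fact (j - i)) (e j))) \<and>
       \<phi> x = scale \<gamma> (e 1) + x \<and>
       \<phi> y = y)"
proof -
  interpret R1_algebra scale bracket n e x y by fact
  show ?thesis
    unfolding coef_def[symmetric]
  proof
    assume "automorphism \<phi>"
    then show "\<exists>\<alpha> \<beta> \<gamma>. \<alpha> * \<beta> \<noteq> 0 \<and> \<phi> (e 1) = scale \<alpha> (e 1) \<and>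
        (\<forall>i\<in>{2..n}. \<phi> (e i) = (\<Sum>j=i..n. scale (coef \<alpha> \<beta> \<gamma> i j) (e j))) \<and>
        \<phi> x = scale \<gamma> (e 1) + x \<and> \<phi> y = y"
      by (rule normal_form_if_automorphism[OF assms(2)]) blast
  next
    assume "\<exists>\<alpha> \<beta> \<gamma>. \<alpha> * \<beta> \<noteq> 0 \<and> \<phi> (e 1) = scale \<alpha> (e 1) \<and>
        (\<forall>i\<in>{2..n}. \<phi> (e i) = (\<Sum>j=i..n. scale (coef \<alpha> \<beta> \<gamma> i j) (e j))) \<and>
        \<phi> x = scale \<gamma> (e 1) + x \<and> \<phi> y = y"
    then show "automorphism \<phi>"
      by (elim exE conjE) (rule automorphism_if_normal_form[OF assms(2)], auto)
  qed
qed

end
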